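(* For every $\epsilon>0$ there is a positive integer $L$ such that the gap of the quadrahelix $\mathrm{QH}_L$ is less than $\epsilon$.
   Context: Basic points: let $r=\frac{3\sqrt3}{10}$, $h=\frac1{\sqrt{10}}$, $\theta=\cos^{-1}(-\frac23)$, and for $i\in\mathbb Z$ let $V_i=(r\cos(i\theta),\,r\sin(i\theta),\,ih)\in\mathbb R^3$. Let $T_0$ be the regular tetrahedron of side 1 with ordered vertices $(V_{-1},V_0,V_1,V_2)$, carrying labels $1,2,3,4$ respectively. Chains from strings: if $T$ is a regular tetrahedron with ordered (labelled) vertices $1,2,3,4$, then reflecting $T$ in face $i$ means replacing the vertex labelled $i$ by its mirror image in the plane of the face opposite to it (the other three vertices and all labels being kept). A string $r_0,r_1,\dots,r_{n-1}$ in $\{1,2,3,4\}$ with consecutive entries distinct determines labelled tetrahedra $T_1,\dots,T_n$, where $T_{k}$ is obtained from $T_{k-1}$ by reflecting in face $r_{k-1}$ ($1\le k\le n$). The chain is $(T_1,\dots,T_n)$; its reflection sequence is $r_1,\dots,r_{n-1}$. $T_0$ is only an auxiliary "invisible" tetrahedron, not part of the chain. For a given reflection sequence $r_1,\dots,r_{n-1}$ ($n\ge2$) there are three admissible choices of $r_0$, namely the elements of $\{1,2,3,4\}\setminus\{r_1\}$; they give congruent chains in different positions, and in particular different positions of $T_n$. Gap: the gap of a chain with reflection sequence $r_1,\dots,r_{n-1}$ is the minimum, over the three admissible choices of $r_0$, of the Hausdorff distance between the solid tetrahedra $T_0$ and $T_n$. (The Hausdorff distance of compact sets $X,Y$ is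 the smallest $c\ge0$ such that each point of $X$ is within $c$ of $Y$ and each point of $Y$ is within $c$ of $X$.) Quadrahelix: let $S_m$ be the $m$-term string $2,3,4,1,2,3,4,1,\dots$ (its $k$-th term is the element of $\{1,2,3,4\}$ congruent to $k+1$ mod 4). For even $m$ let $\Sigma_m$ be $S_{m+1}$ with its middle entry deleted. For a string $s$ let $\overline{s}$ be its reversal. For a positive integer $L$, the quadrahelix $\mathrm{QH}_L$ is the chain of $4L+2$ tetrahedra $T_1,\dots,T_{4L+2}$ determined by the string (of length $4L+2$, starting with $r_0=1$) $\;1\ \Sigma_{2L}\ j\ \overline{\Sigma_{2L}}$, where $j=3$ if $L$ is even and $j=1$ if $L$ is odd. Thus its reflection sequence is $\Sigma_{2L}\ j\ \overline{\Sigma_{2L}}$. *)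

theory Defs
  imports "HOL-Analysis.Analysis" "HOL-Number_Theory.Cong"
begin

(* A labelled tetrahedron sends a label to the vertex carrying it; only its values on the
   labels 1, 2, 3, 4 are meaningful. *)
type_synonym labelled_tetrahedron = "nat \<Rightarrow> real ^ 3"

definition labels :: "nat set" where
  "labels = {1, 2, 3, 4}"

definition solid :: "labelled_tetrahedron \<Rightarrow> (real ^ 3) set" where
  "solid T = convex hull (T ` labels)"

definition basic_point :: "int \<Rightarrow> real ^ 3" where
  "basic_point i =
     (let r = 3 * sqrt 3 / 10; h = 1 / sqrt 10; \<theta> = arccos (- (2 / 3))
      in vector [r * cos (of_int i * \<theta>), r * sin (of_int i * \<theta>), of_int i * h])"

definition base_tetrahedron :: labelled_tetrahedron where
  "base_tetrahedron l = basic_point (int l - 2)"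

(* On an affine hull, closest_point is the orthogonal projection. *)
definition mirror_image :: "(real ^ 3) set \<Rightarrow> real ^ 3 \<Rightarrow> real ^ 3" where
  "mirror_image F p = 2 *\<^sub>R closest_point (affine hull F) p - p"

definition reflect_in_face :: "nat \<Rightarrow> labelled_tetrahedron \<Rightarrow> labelled_tetrahedron" where
  "reflect_in_face i T = T(i := mirror_image (T ` (labels - {i})) (T i))"

fun chain_from :: "labelled_tetrahedron \<Rightarrow> nat list \<Rightarrow> labelled_tetrahedron list" where
  "chain_from T [] = []"
| "chain_from T (i # s) = reflect_in_face i T # chain_from (reflect_in_face i T) s"

(* The invisible initial tetrahedron is not a member of the chain. *)
definition chain :: "nat list \<Rightarrow> labelled_tetrahedron list" where
  "chain s = chain_from base_tetrahedron s"

definition reflection_sequence :: "nat list \<Rightarrow> nat list" where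
  "reflection_sequence s = tl s"

(* The infimum is attained when X and Y are compact and nonempty. *)
definition hausdorff_distance :: "'a::metric_space set \<Rightarrow> 'a set \<Rightarrow> real" where
  "hausdorff_distance X Y =
     Inf {c. 0 \<le> c \<and> (\<forall>x\<in>X. \<exists>y\<in>Y. dist x y \<le> c) \<and> (\<forall>y\<in>Y. \<exists>x\<in>X. dist y x \<le> c)}"

(* The argument is a nonempty reflection sequence. *)
definition gap :: "nat list \<Rightarrow> real" where
  "gap rs =
     Min ((\<lambda>i. hausdorff_distance (solid base_tetrahedron) (solid (last (chain (i # rs)))))
          ` (labels - {hd rs}))"

definition cyclic_string :: "nat \<Rightarrow> nat list" where
  "cyclic_string m = map (\<lambda>k. THE l. l \<in> labels \<and> [l = k + 1] (mod 4)) [1..<m + 1]"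

(* For even m: the middle entry of a string of length m + 1 has zero-based position m div 2. *)
definition deleted_string :: "nat \<Rightarrow> nat list" where
  "deleted_string m =
     take (m div 2) (cyclic_string (m + 1)) @ drop (m div 2 + 1) (cyclic_string (m + 1))"

(* A chain is represented by the string that determines it. *)
definition quadrahelix :: "nat \<Rightarrow> nat list" where
  "quadrahelix L =
     1 # deleted_string (2 * L) @ (if even L then 3 else 1) # rev (deleted_string (2 * L))"

end

theory Submission
  imports Defs
begin

text \<open>
  Let \<open>\<rho>\<close> be the reflection in the plane \<open>P\<close> of face 1 of the base tetrahedron \<open>T\<close>, and let
  \<open>s\<close> be the screw motion along the helix of basic points that shifts the index by \<open>4q\<close>; it
  rotates by \<open>\<phi> = 4q\<theta>\<close> and climbs by \<open>a = 4q/\<surd>10\<close>. Mirroring a vertex of a regular tetrahedron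
  is an affine recipe in the four vertices, so it commutes with isometries, and therefore a string
  that carries \<open>T\<close> to \<open>f(T)\<close> followed by one that carries \<open>T\<close> to \<open>g(T)\<close> carries \<open>T\<close> to \<open>f(g(T))\<close>
  (\<open>represents_append\<close>). In this sense the string \<open>(1 2 3 4)\<^sup>q\<close> represents \<open>s\<close> and the string \<open>1\<close>
  represents \<open>\<rho>\<close>.

  Take \<open>L = 4q - 1\<close>. The deleted entry of the quadrahelix is then the 1 that starts a period, and
  deleting it has the same effect as doubling it, since mirroring twice in the same face does
  nothing. So the first half of the quadrahelix represents \<open>h = s\<rho>s\<close>. The second half
  mirrors in face 1 and runs back, which makes the whole string represent the product
  of the reflection in \<open>h(P)\<close> with \<open>\<rho>\<close> (\<open>represents_quadrahelix\<close>). The chain nearly closes exactly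
  when the planes \<open>h(P)\<close> and \<open>P\<close> nearly coincide near \<open>T\<close>.

  If \<open>s\<close> were a pure translation, \<open>s\<rho>s\<rho>\<close> would be a translation parallel to \<open>P\<close>, and \<open>h(P) = P\<close>.
  In general \<open>h(P)\<close> is close to \<open>P\<close> if and only if \<open>\<rho>(s(P))\<close> is close to \<open>s\<inverse>(P)\<close>. The half-turn about the line
  of \<open>P\<close> that meets the axis of \<open>s\<close> at a right angle exchanges \<open>s(P)\<close> and \<open>s\<inverse>(P)\<close>; hence
  \<open>\<rho>(s(P))\<close> and \<open>s\<inverse>(P)\<close> are mirror images in the plane \<open>Q\<close> through that line orthogonal to \<open>P\<close>.
  They coincide when their normals lie in \<open>Q\<close>, and the deviation from this is even in \<open>\<phi>\<close>, namely
  proportional to \<open>1 - cos \<phi>\<close> (\<open>bent_screw_normal\<close>). The two planes meet at distance of order \<open>a\<close>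
  from \<open>T\<close>, so the displacement of \<open>T\<close> is governed by \<open>a (1 - cos \<phi>)\<close>
  (\<open>bent_screw_plane_tendsto\<close>).

  The quadratic order is decisive. By Dirichlet's theorem, for each \<open>N\<close> some \<open>q \<le> N\<close> brings \<open>\<phi>\<close>
  within \<open>O(1/N)\<close> of a multiple of \<open>2\<pi>\<close>; then \<open>a (1 - cos \<phi>)\<close> is of order
  \<open>N \<cdot> 1/N\<^sup>2\<close> (\<open>exists_multiples_cos_close\<close>). A deviation linear in \<open>\<phi>\<close> would leave a bounded error only.
\<close>

section \<open>Reflections and regular tetrahedra\<close>

definition reflection :: "'a::real_inner \<Rightarrow> 'a \<Rightarrow> 'a \<Rightarrow> 'a" where
  "reflection n p x = x - (2 * ((x - p) \<bullet> n)) *\<^sub>R n"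

lemma reflection_reflection:
  assumes "norm n = 1"
  shows "reflection n p (reflection n p x) = x"
proof -
  have "n \<bullet> n = 1" using assms by (simp add: norm_eq_1)
  then show ?thesis
    by (simp add: reflection_def algebra_simps flip: scaleR_add_left)
qed

lemma dist_reflection:
  assumes "norm n = 1"
  shows "dist (reflection n p x) (reflection n p y) = dist x y"
proof -
  have n: "n \<bullet> n = 1" using assms by (simp add: norm_eq_1)
  have "reflection n p x - reflection n p y = (x - y) - (2 * ((x - y) \<bullet> n)) *\<^sub>R n"
    by (simp add: reflection_def algebra_simps)
  also have "\<dots> \<bullet> \<dots> = (x - y) \<bullet> (x - y)"
    using n by (simp add: inner_diff_left[of "x - y" "_ *\<^sub>R n"] inner_diff_right[of _ "x - y" "_ *\<^sub>R n"]
        inner_commute[of n "x - y"])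
  finally show ?thesis
    by (simp add: dist_norm norm_eq_sqrt_inner)
qed

lemma reflection_conjugate:
  assumes "linear H" and "\<And>x y. H x \<bullet> H y = x \<bullet> y" and "\<And>x. h x = H x + t"
  shows "h (reflection n p x) = reflection (H n) (h p) (h x)"
proof -
  have "(h x - h p) \<bullet> H n = (x - p) \<bullet> n"
    using assms by (metis add_diff_cancel_right linear_diff)
  then show ?thesis
    by (simp add: reflection_def assms(3) linear_diff[OF assms(1)] linear_cmul[OF assms(1)])
qed

definition regular :: "labelled_tetrahedron \<Rightarrow> bool" where
  "regular T \<longleftrightarrow> (\<forall>i\<in>labels. \<forall>j\<in>labels. i \<noteq> j \<longrightarrow> dist (T i) (T j) = 1)"

text \<open>In terms of the edge vectors from \<open>p\<close> all inner products are 1 or 1/2, so the altitude \<open>d\<close>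
  from the centroid of the opposite face is orthogonal to that face by direct expansion.\<close>
lemma regular_simplex_altitude:
  fixes p a b c :: "'a::real_inner"
  assumes "dist p a = 1" "dist p b = 1" "dist p c = 1" "dist a b = 1" "dist a c = 1" "dist b c = 1"
  defines "d \<equiv> p - (1/3) *\<^sub>R (a + b + c)"
  shows "d \<bullet> (a - b) = 0" "d \<bullet> (a - c) = 0" "(p - a) \<bullet> d = d \<bullet> d" "d \<noteq> 0"
proof -
  define u v w where uvw: "u = a - p" "v = b - p" "w = c - p"
  have 1: "u \<bullet> u = 1" "v \<bullet> v = 1" "w \<bullet> w = 1"
    using assms(1-3) by (auto simp: uvw dist_norm norm_eq_1 norm_minus_commute)
  have "(u - v) \<bullet> (u - v) = 1" "(u - w) \<bullet> (u - w) = 1" "(v - w) \<bullet> (v - w) = 1"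
    using assms(4-6) by (auto simp: uvw dist_norm norm_eq_1)
  then have 2: "u \<bullet> v = 1/2" "u \<bullet> w = 1/2" "v \<bullet> w = 1/2" "v \<bullet> u = 1/2" "w \<bullet> u = 1/2" "w \<bullet> v = 1/2"
    using 1 by (auto simp: inner_diff_left inner_diff_right inner_commute)
  have d: "d = - ((1/3) *\<^sub>R (u + v + w))"
    by (simp add: d_def uvw algebra_simps flip: scaleR_add_left)
  have ab: "a - b = u - v" "a - c = u - w" "p - a = - u"
    by (simp_all add: uvw)
  have dd: "d \<bullet> d = 2/3"
    by (simp add: d inner_add_left inner_add_right 1 2)
  then show "d \<noteq> 0" by auto
  show "d \<bullet> (a - b) = 0" "d \<bullet> (a - c) = 0" "(p - a) \<bullet> d = d \<bullet> d"
    unfolding ab dd by (simp_all add: d inner_add_left inner_add_right inner_diff_right 1 2)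
qed

text \<open>The orthogonal projection onto the plane of a face is its centroid, because the altitude is
  orthogonal to all of the plane; this turns the mirror image into an affine combination of the
  vertices.\<close>
lemma mirror_image_regular_simplex:
  fixes p a b c :: "real ^ 3"
  assumes "dist p a = 1" "dist p b = 1" "dist p c = 1" "dist a b = 1" "dist a c = 1" "dist b c = 1"
  shows "mirror_image {a, b, c} p = (2/3) *\<^sub>R (a + b + c) - p"
proof -
  define m where "m = (1/3) *\<^sub>R (a + b + c)"
  define A where "A = affine hull {a, b, c}"
  have orth: "(p - m) \<bullet> (a - b) = 0" "(p - m) \<bullet> (a - c) = 0"
    using regular_simplex_altitude[OF assms] by (simp_all add: m_def)
  have "m \<in> A"
    unfolding A_def m_def affine_hull_3
    by (auto simp: scaleR_add_right intro!: exI[of _ "1/3"])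
  have ortho: "(p - m) \<bullet> (x - m) = 0" if "x \<in> A" for x
  proof -
    have "{a, b, c} \<subseteq> {y. (p - m) \<bullet> y = (p - m) \<bullet> a}"
      using orth by (auto simp: inner_diff_right)
    then have "A \<subseteq> {y. (p - m) \<bullet> y = (p - m) \<bullet> a}"
      unfolding A_def by (rule hull_minimal) (rule affine_hyperplane)
    with that \<open>m \<in> A\<close> have "(p - m) \<bullet> x = (p - m) \<bullet> m"
      by (metis (mono_tags, lifting) mem_Collect_eq subsetD)
    then show ?thesis
      by (simp add: inner_diff_right)
  qed
  have "dist p m \<le> dist p x" if "x \<in> A" for x
  proof -
    have "(dist p x)\<^sup>2 = (dist p m)\<^sup>2 + (dist m x)\<^sup>2"
      using ortho[OF that] unfolding dist_norm power2_norm_eq_inner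
      by (simp add: inner_diff_left inner_diff_right inner_commute)
    then have "(dist p m)\<^sup>2 \<le> (dist p x)\<^sup>2" by simp
    then show ?thesis by (rule power2_le_imp_le) simp
  qed
  then have "closest_point A p = m"
    using closest_point_unique[of A m p] \<open>m \<in> A\<close>
    by (simp add: A_def affine_imp_convex)
  then show ?thesis
    by (simp add: mirror_image_def A_def m_def)
qed

section \<open>Strings acting on labelled points\<close>

text \<open>The affine recipe for mirroring. It agrees with reflection in a face on regular tetrahedra, and it
  is an involution that commutes with affine maps on arbitrary labelled points.\<close>
definition flip_vertex :: "nat \<Rightarrow> labelled_tetrahedron \<Rightarrow> labelled_tetrahedron" where
  "flip_vertex i T = T(i := (2/3) *\<^sub>R (\<Sum>k\<in>labels - {i}. T k) - T i)"

lemma other_labels: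
  assumes "i \<in> labels"
  obtains a b c where "labels - {i} = {a, b, c}" "a \<noteq> b" "a \<noteq> c" "b \<noteq> c" "i \<noteq> a" "i \<noteq> b" "i \<noteq> c"
    "a \<in> labels" "b \<in> labels" "c \<in> labels"
proof -
  have "card (labels - {i}) = 3"
    using assms by (auto simp: labels_def)
  then obtain a b c where "labels - {i} = {a, b, c}" "a \<noteq> b" "a \<noteq> c" "b \<noteq> c"
    by (auto simp: card_3_iff)
  then show thesis using that by blast
qed

text \<open>Regularity propagates along a chain because one and the same reflection moves the flipped vertex
  and fixes the other three: the new tetrahedron is an isometric image of the old one.\<close>
lemma flip_vertex_regular:
  assumes "regular T" "i \<in> labels"
  shows "reflect_in_face i T = flip_vertex i T"
    and "\<exists>n p. norm n = 1 \<and> (\<forall>l\<in>labels. flip_vertex i T l = reflection n p (T l))"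
    and "regular (flip_vertex i T)"
proof -
  obtain a b c where abc: "labels - {i} = {a, b, c}" "a \<noteq> b" "a \<noteq> c" "b \<noteq> c" "i \<noteq> a" "i \<noteq> b" "i \<noteq> c"
    and lab: "a \<in> labels" "b \<in> labels" "c \<in> labels"
    using other_labels[OF assms(2)] by metis
  have unit: "dist (T i) (T a) = 1" "dist (T i) (T b) = 1" "dist (T i) (T c) = 1"
      "dist (T a) (T b) = 1" "dist (T a) (T c) = 1" "dist (T b) (T c) = 1"
    using assms abc lab unfolding regular_def by blast+
  have flip: "flip_vertex i T = T(i := (2/3) *\<^sub>R (T a + T b + T c) - T i)"
    using abc by (simp add: flip_vertex_def add.assoc)
  show "reflect_in_face i T = flip_vertex i T"
    unfolding reflect_in_face_def flip
    using mirror_image_regular_simplex[OF unit] abc by simp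
  define d where "d = T i - (1/3) *\<^sub>R (T a + T b + T c)"
  define n where "n = d /\<^sub>R norm d"
  note alt = regular_simplex_altitude[OF unit, folded d_def]
  have n1: "norm n = 1"
    using alt(4) by (simp add: n_def)
  have refl: "reflection n (T a) x = x - (2 * ((x - T a) \<bullet> d) / (d \<bullet> d)) *\<^sub>R d" for x
    by (simp add: reflection_def n_def divide_inverse power2_norm_eq_inner[symmetric] power2_eq_square)
  have "(T b - T a) \<bullet> d = 0" "(T c - T a) \<bullet> d = 0"
    using alt(1,2) by (simp_all add: inner_diff_left inner_diff_right inner_commute)
  then have face: "reflection n (T a) (T k) = T k" if "k \<in> {a, b, c}" for k
    using that by (auto simp: refl)
  have "(2/3) *\<^sub>R (T a + T b + T c) - T i = T i - 2 *\<^sub>R d"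
    by (simp add: d_def algebra_simps scaleR_2)
  also have "\<dots> = reflection n (T a) (T i)"
    using alt(3,4) by (simp add: refl)
  finally have "flip_vertex i T i = reflection n (T a) (T i)"
    by (simp add: flip)
  moreover have "flip_vertex i T l = reflection n (T a) (T l)" if "l \<in> labels" "l \<noteq> i" for l
  proof -
    have "l \<in> {a, b, c}"
      using that abc(1) by blast
    then show ?thesis
      using that(2) by (simp add: flip face del: insert_iff)
  qed
  ultimately have "flip_vertex i T l = reflection n (T a) (T l)" if "l \<in> labels" for l
    using that by blast
  then show ex: "\<exists>n p. norm n = 1 \<and> (\<forall>l\<in>labels. flip_vertex i T l = reflection n p (T l))"
    using n1 by blast
  then show "regular (flip_vertex i T)"
    using assms(1) by (auto simp: regular_def dist_reflection)
qed

definition act :: "nat list \<Rightarrow> labelled_tetrahedron \<Rightarrow> labelled_tetrahedron" where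
  "act w T = foldl (\<lambda>T i. flip_vertex i T) T w"

lemma act_simps [simp]:
  "act [] T = T" "act (i # w) T = act w (flip_vertex i T)" "act (u @ w) T = act w (act u T)"
  by (simp_all add: act_def)

lemma last_chain_from:
  assumes "regular T" "set w \<subseteq> labels" "w \<noteq> []"
  shows "last (chain_from T w) = act w T"
  using assms
proof (induction w arbitrary: T)
  case (Cons i w)
  show ?case
  proof (cases "w = []")
    case False
    moreover from False have "chain_from X w \<noteq> []" for X
      by (cases w) auto
    ultimately show ?thesis
      using Cons flip_vertex_regular by simp
  qed (use Cons flip_vertex_regular in auto)
qed simp

lemma flip_vertex_flip_vertex: "flip_vertex i (flip_vertex i T) = T"
  by (simp add: flip_vertex_def)

lemma act_rev: "act (rev w) (act w T) = T"
  by (induction w arbitrary: T) (simp_all add: flip_vertex_flip_vertex)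

lemma act_cong:
  assumes "\<And>l. l \<in> labels \<Longrightarrow> T l = T' l" "l \<in> labels"
  shows "act w T l = act w T' l"
proof -
  have "\<forall>l\<in>labels. flip_vertex i X l = flip_vertex i Y l" if "\<forall>l\<in>labels. X l = Y l" for i X Y
    using that by (auto simp: flip_vertex_def intro!: sum.cong)
  then have "(\<forall>l\<in>labels. X l = Y l) \<Longrightarrow> (\<forall>l\<in>labels. act w X l = act w Y l)" for X Y
    by (induction w arbitrary: X Y) auto
  then show ?thesis using assms by blast
qed

definition affine_map :: "('a::real_vector \<Rightarrow> 'a) \<Rightarrow> bool" where
  "affine_map g \<longleftrightarrow> (\<exists>H t. linear H \<and> g = (\<lambda>x. H x + t))"

lemma flip_vertex_affine_map:
  assumes "affine_map g" "i \<in> labels"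
  shows "flip_vertex i (g \<circ> T) = g \<circ> flip_vertex i T"
proof -
  obtain H t where H: "linear H" and g: "g = (\<lambda>x. H x + t)"
    using assms(1) by (auto simp: affine_map_def)
  obtain a b c where abc: "labels - {i} = {a, b, c}" "a \<noteq> b" "a \<noteq> c" "b \<noteq> c"
    using other_labels[OF assms(2)] by metis
  have "t + t + t = 3 *\<^sub>R t"
    using scaleR_add_left[of 2 1 t] by (simp add: scaleR_2)
  then have "(2/3) *\<^sub>R (t + t + t) = 2 *\<^sub>R t" by simp
  then have "(2/3) *\<^sub>R ((H x + t) + ((H y + t) + (H z + t))) - (H w + t)
      = H ((2/3) *\<^sub>R (x + (y + z)) - w) + t" for x y z w
    by (simp add: linear_diff[OF H] linear_cmul[OF H] linear_add[OF H] algebra_simps scaleR_2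
        flip: scaleR_add_left)
  then show ?thesis
    using abc by (auto simp: flip_vertex_def g fun_eq_iff)
qed

lemma act_affine_map:
  assumes "affine_map g" "set w \<subseteq> labels"
  shows "act w (g \<circ> T) = g \<circ> act w T"
  using assms(2) by (induction w arbitrary: T) (simp_all add: flip_vertex_affine_map[OF assms(1)])

lemma affine_map_reflection: "affine_map (reflection n p)"
  unfolding affine_map_def
  by (rule exI[of _ "\<lambda>x. x - (2 * (x \<bullet> n)) *\<^sub>R n"], rule exI[of _ "(2 * (p \<bullet> n)) *\<^sub>R n"])
    (auto simp: reflection_def fun_eq_iff algebra_simps linear_iff)

lemma affine_map_comp:
  assumes "affine_map f" "affine_map g"
  shows "affine_map (f \<circ> g)"
proof -
  obtain F s G t where F: "linear F" "f = (\<lambda>x. F x + s)" and G: "linear G" "g = (\<lambda>x. G x + t)"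
    using assms by (auto simp: affine_map_def)
  then have "f \<circ> g = (\<lambda>x. (F \<circ> G) x + (F t + s))"
    by (auto simp: fun_eq_iff linear_add)
  then show ?thesis
    using F G linear_compose unfolding affine_map_def by blast
qed

text \<open>Only the four labels matter, and the vertices of \<open>T\<close> are the only points at which \<open>g\<close> is
  compared; affinity of \<open>g\<close> is what allows it to be carried past further flips.\<close>
definition represents :: "labelled_tetrahedron \<Rightarrow> nat list \<Rightarrow> (real ^ 3 \<Rightarrow> real ^ 3) \<Rightarrow> bool" where
  "represents T w g \<longleftrightarrow>
     affine_map g \<and> set w \<subseteq> labels \<and> (\<forall>l\<in>labels. act w T l = g (T l))"

text \<open>The later string acts on \<open>f(T)\<close>; its flips commute with \<open>f\<close>, so its effect \<open>g\<close> is applied to \<open>T\<close>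
  first. Hence composition follows the order of the strings.\<close>
lemma represents_append:
  assumes "represents T u f" "represents T w g"
  shows "represents T (u @ w) (f \<circ> g)"
proof -
  have "act w (act u T) l = f (g (T l))" if "l \<in> labels" for l
  proof -
    have "act w (act u T) l = act w (f \<circ> T) l"
      using assms(1) that by (intro act_cong) (simp_all add: represents_def)
    also have "\<dots> = f (act w T l)"
      using assms by (simp add: act_affine_map represents_def)
    also have "\<dots> = f (g (T l))"
      using assms that by (simp add: represents_def)
    finally show ?thesis .
  qed
  then show ?thesis
    using assms by (auto simp: represents_def affine_map_comp)
qed

text \<open>Flipping \<open>i\<close> at the turning point reflects the tetrahedron \<open>h(T)\<close> in the image under \<open>h\<close> of face \<open>i\<close>.
  That reflection is affine, so it can be carried past the way back, and the way back undoes the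
  way out except for its first flip.\<close>
lemma represents_palindrome:
  assumes w: "represents T (i # w) h" and i: "represents T [i] (reflection n p)"
    and H: "linear H" "\<And>x y. H x \<bullet> H y = x \<bullet> y" "\<And>x. h x = H x + t"
  shows "represents T (i # w @ i # rev w) (reflection (H n) (h p) \<circ> reflection n p)"
proof -
  define R where "R = reflection (H n) (h p)"
  have aff: "affine_map R"
    by (simp add: R_def affine_map_reflection)
  let ?U = "act (i # w) T"
  have lab: "i \<in> labels" "set w \<subseteq> labels" "set (rev w) \<subseteq> labels"
    using w by (auto simp: represents_def)
  have "flip_vertex i ?U l = (R \<circ> ?U) l" if "l \<in> labels" for l
  proof -
    have "represents T ((i # w) @ [i]) (h \<circ> reflection n p)"
      using w i by (rule represents_append)
    then have "flip_vertex i ?U l = h (reflection n p (T l))"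
      using that by (simp add: represents_def)
    also have "\<dots> = R (h (T l))"
      unfolding R_def by (rule reflection_conjugate[OF H])
    also have "h (T l) = ?U l"
      using w that by (simp add: represents_def)
    finally show ?thesis by simp
  qed
  then have "act (rev w) (flip_vertex i ?U) l = (R \<circ> reflection n p) (T l)" if "l \<in> labels" for l
  proof -
    have "act (rev w) (flip_vertex i ?U) l = act (rev w) (R \<circ> ?U) l"
      using \<open>\<And>l. l \<in> labels \<Longrightarrow> flip_vertex i ?U l = (R \<circ> ?U) l\<close> that by (rule act_cong)
    also have "\<dots> = R (act (rev w) (act w (flip_vertex i T)) l)"
      by (simp add: act_affine_map[OF aff lab(3)])
    also have "\<dots> = R (flip_vertex i T l)"
      by (simp add: act_rev)
    also have "flip_vertex i T l = reflection n p (T l)"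
      using i that by (simp add: represents_def)
    finally show ?thesis by simp
  qed
  then show ?thesis
    using lab aff by (auto simp: represents_def R_def affine_map_reflection affine_map_comp)
qed

section \<open>Screw motions\<close>

definition rotation :: "real \<Rightarrow> real ^ 3 \<Rightarrow> real ^ 3" where
  "rotation \<phi> x = vector [cos \<phi> * x$1 - sin \<phi> * x$2, sin \<phi> * x$1 + cos \<phi> * x$2, x$3]"

abbreviation vertical :: "real ^ 3" where
  "vertical \<equiv> axis 3 1"

definition screw :: "real \<Rightarrow> real \<Rightarrow> real ^ 3 \<Rightarrow> real ^ 3" where
  "screw \<phi> a x = rotation \<phi> x + a *\<^sub>R vertical"

lemmas coordinates_3 = vec_eq_iff forall_3 inner_vec_def sum_3 axis_def

lemma linear_rotation: "linear (rotation \<phi>)"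
  by (auto simp: linear_iff rotation_def coordinates_3 algebra_simps)

lemma rotation_inner: "rotation \<phi> x \<bullet> rotation \<phi> y = x \<bullet> y"
proof -
  have "sin \<phi> ^ 2 + cos \<phi> ^ 2 = 1" by simp
  then show ?thesis
    unfolding rotation_def coordinates_3 by (simp del: sin_cos_squared_add) algebra
qed

lemma screw_screw: "screw \<phi> a (screw \<psi> b x) = screw (\<phi> + \<psi>) (a + b) x"
  by (simp add: screw_def rotation_def coordinates_3 cos_add sin_add algebra_simps)

lemma affine_map_screw: "affine_map (screw \<phi> a)"
  unfolding affine_map_def screw_def[abs_def] using linear_rotation by blast

lemma rotation_vertical [simp]: "rotation \<phi> vertical = vertical"
  by (simp add: rotation_def coordinates_3)

text \<open>On horizontal vectors this is \<open>R + R\<inverse> = 2 cos \<phi>\<close>; the last term corrects for the fixed vertical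
  component.\<close>
lemma rotation_rotation:
  "rotation \<phi> (rotation \<phi> x) = (2 * cos \<phi>) *\<^sub>R rotation \<phi> x - x + (2 * (1 - cos \<phi>) * x$3) *\<^sub>R vertical"
proof -
  have "sin \<phi> ^ 2 + cos \<phi> ^ 2 = 1" by simp
  then show ?thesis
    unfolding rotation_def coordinates_3
    by (simp del: sin_cos_squared_add, intro conjI) (algebra, algebra, simp add: algebra_simps)
qed

lemma inner_rotation_self:
  assumes "norm n = 1"
  shows "n \<bullet> rotation \<phi> n = cos \<phi> + (1 - cos \<phi>) * (n$3)\<^sup>2"
proof -
  have "n$1 * n$1 + n$2 * n$2 + n$3 * n$3 = 1"
    using assms by (simp add: norm_eq_1 inner_vec_def sum_3)
  then show ?thesis
    unfolding rotation_def coordinates_3 by simp algebra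
qed

lemma tendsto_rotation:
  fixes \<phi> :: "nat \<Rightarrow> real" and x :: "nat \<Rightarrow> real ^ 3"
  assumes "(\<lambda>N. cos (\<phi> N)) \<longlonglongrightarrow> 1" "(\<lambda>N. sin (\<phi> N)) \<longlonglongrightarrow> 0" "x \<longlonglongrightarrow> y"
  shows "(\<lambda>N. rotation (\<phi> N) (x N)) \<longlonglongrightarrow> y"
proof (rule vec_tendstoI)
  fix i :: 3
  have [tendsto_intros]: "(\<lambda>N. x N $ j) \<longlonglongrightarrow> y $ j" for j
    using assms(3) by (rule tendsto_vec_nth)
  have "i = 1 \<or> i = 2 \<or> i = 3" by (rule exhaust_3)
  then show "(\<lambda>N. rotation (\<phi> N) (x N) $ i) \<longlonglongrightarrow> y $ i"
    by (elim disjE; simp add: rotation_def)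
      (rule tendsto_eq_intros assms(1,2) refl | simp)+
qed

text \<open>
  Here \<open>\<nu>\<close> is the normal of the plane obtained from the plane with normal \<open>n\<close> by screw motion,
  reflection, screw motion. It differs from \<open>-n\<close> only by a term of order \<open>1 - cos \<phi>\<close>. The second
  identity concerns the offset of that plane, in which the expression on the left is multiplied by
  twice the height of the screw motion: as heights are unbounded, continuity in \<open>\<phi>\<close> would not be
  enough, and the factor \<open>1 - cos \<phi>\<close> is needed here too.
\<close>
lemma bent_screw_normal:
  fixes n :: "real ^ 3"
  assumes n: "norm n = 1"
  defines "\<eta> \<equiv> \<lambda>\<phi>. 1 - cos \<phi>"
    and "\<nu> \<equiv> \<lambda>\<phi>. rotation \<phi> (rotation \<phi> n - (2 * (rotation \<phi> n \<bullet> n)) *\<^sub>R n)"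
  shows "\<nu> \<phi> = (2 * \<eta> \<phi> * n$3) *\<^sub>R (vertical - n$3 *\<^sub>R rotation \<phi> n) - n"
    and "\<nu> \<phi> \<bullet> vertical - n$3 * (\<nu> \<phi> \<bullet> rotation \<phi> n) = \<eta> \<phi> * n$3 * (1 - (n$3)\<^sup>2)"
proof -
  let ?R = "rotation \<phi>"
  have nRn: "n \<bullet> ?R n = 1 - \<eta> \<phi> * (1 - (n$3)\<^sup>2)"
    unfolding inner_rotation_self[OF n] \<eta>_def by (simp add: algebra_simps)
  have "\<nu> \<phi> = ?R (?R n) - (2 * (n \<bullet> ?R n)) *\<^sub>R ?R n"
    by (simp add: \<nu>_def linear_diff[OF linear_rotation] linear_cmul[OF linear_rotation] inner_commute)
  also have "\<dots> = (2 * (cos \<phi> - n \<bullet> ?R n)) *\<^sub>R ?R n + (2 * \<eta> \<phi> * n$3) *\<^sub>R vertical - n"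
    unfolding rotation_rotation \<eta>_def by (simp add: algebra_simps)
  also have "2 * (cos \<phi> - n \<bullet> ?R n) = - (2 * \<eta> \<phi> * n$3 * n$3)"
    unfolding nRn \<eta>_def by (simp add: algebra_simps power2_eq_square)
  finally show \<nu>: "\<nu> \<phi> = (2 * \<eta> \<phi> * n$3) *\<^sub>R (vertical - n$3 *\<^sub>R ?R n) - n"
    by (simp add: algebra_simps)
  have unit: "?R n \<bullet> ?R n = 1" "vertical \<bullet> vertical = (1::real)"
    using n by (simp_all add: rotation_inner norm_eq_1)
  have e: "x \<bullet> vertical = x$3" for x :: "real ^ 3"
    by (simp add: inner_axis)
  have R3: "?R n $ 3 = n$3"
    by (simp add: rotation_def)
  show "\<nu> \<phi> \<bullet> vertical - n$3 * (\<nu> \<phi> \<bullet> ?R n) = \<eta> \<phi> * n$3 * (1 - (n$3)\<^sup>2)"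
    unfolding \<nu> inner_diff_left inner_scaleR_left unit inner_commute[of vertical "?R n"] e R3 nRn
    by (simp add: R3 algebra_simps power2_eq_square)
qed

text \<open>Although the heights \<open>a\<close> may tend to infinity, the reflections in the transported planes converge
  to the reflection in the original plane as soon as \<open>a (1 - cos \<phi>)\<close> vanishes in the limit.\<close>
lemma bent_screw_plane_tendsto:
  fixes n p y :: "real ^ 3" and \<phi> a :: "nat \<Rightarrow> real"
  assumes n: "norm n = 1"
    and cos: "(\<lambda>N. cos (\<phi> N)) \<longlonglongrightarrow> 1" and a: "(\<lambda>N. a N * (1 - cos (\<phi> N))) \<longlonglongrightarrow> 0"
  shows "(\<lambda>N. reflection (rotation (\<phi> N) (rotation (\<phi> N) n - (2 * (rotation (\<phi> N) n \<bullet> n)) *\<^sub>R n))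
           (screw (\<phi> N) (a N) (reflection n p (screw (\<phi> N) (a N) p))) y) \<longlonglongrightarrow> reflection n p y"
proof -
  define R where "R = (\<lambda>N. rotation (\<phi> N))"
  define \<nu> where "\<nu> = (\<lambda>N. R N (R N n - (2 * (R N n \<bullet> n)) *\<^sub>R n))"
  define h where "h = (\<lambda>N. screw (\<phi> N) (a N) (reflection n p (screw (\<phi> N) (a N) p)))"
  have "(\<lambda>N. (sin (\<phi> N))\<^sup>2) \<longlonglongrightarrow> 0"
    unfolding sin_squared_eq by (rule tendsto_eq_intros cos refl | simp)+
  then have sin: "(\<lambda>N. sin (\<phi> N)) \<longlonglongrightarrow> 0"
    by (simp add: tendsto_null_power)
  have R: "(\<lambda>N. R N (x N)) \<longlonglongrightarrow> z" if "x \<longlonglongrightarrow> z" for x z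
    using tendsto_rotation[OF cos sin that] by (simp add: R_def)
  have nn: "n \<bullet> n = 1" using n by (simp add: norm_eq_1)
  have Rn: "(\<lambda>N. R N n) \<longlonglongrightarrow> n" "(\<lambda>N. R N p) \<longlonglongrightarrow> p"
    by (simp_all add: R)
  have RR: "(\<lambda>N. R N (R N p)) \<longlonglongrightarrow> p"
    by (rule R[OF Rn(2)])
  have "(\<lambda>N. R N n - (2 * (R N n \<bullet> n)) *\<^sub>R n) \<longlonglongrightarrow> n - (2 * (n \<bullet> n)) *\<^sub>R n"
    by (intro tendsto_intros Rn)
  then have \<nu>: "\<nu> \<longlonglongrightarrow> - n"
    unfolding \<nu>_def using R by (auto simp: nn scaleR_2)
  \<comment> \<open>The height enters the transported point only through the last summand.\<close>
  have h: "h N = R N (R N p) - (2 * ((R N p - p) \<bullet> n)) *\<^sub>R R N n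
      + (2 * a N) *\<^sub>R (vertical - n$3 *\<^sub>R R N n)" for N
  proof -
    have "vertical \<bullet> n = n$3"
      by (simp add: inner_commute[of vertical] inner_axis)
    then show ?thesis
      unfolding h_def screw_def reflection_def R_def
      by (simp add: linear_diff[OF linear_rotation] linear_cmul[OF linear_rotation]
          linear_add[OF linear_rotation] inner_add_left inner_diff_left algebra_simps)
        (simp add: vec_eq_iff)
  qed
  have "\<nu> N \<bullet> h N = \<nu> N \<bullet> (R N (R N p) - (2 * ((R N p - p) \<bullet> n)) *\<^sub>R R N n)
      + 2 * (a N * (1 - cos (\<phi> N))) * (n$3 * (1 - (n$3)\<^sup>2))" for N
    using bent_screw_normal(2)[OF n, of "\<phi> N"]
    unfolding h inner_add_right by (simp add: \<nu>_def R_def inner_diff_right)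
  moreover have "(\<lambda>N. \<nu> N \<bullet> (R N (R N p) - (2 * ((R N p - p) \<bullet> n)) *\<^sub>R R N n)
      + 2 * (a N * (1 - cos (\<phi> N))) * (n$3 * (1 - (n$3)\<^sup>2)))
    \<longlonglongrightarrow> - n \<bullet> (p - (2 * ((p - p) \<bullet> n)) *\<^sub>R n) + 2 * 0 * (n$3 * (1 - (n$3)\<^sup>2))"
    by (intro tendsto_intros \<nu> Rn RR a)
  ultimately have off: "(\<lambda>N. \<nu> N \<bullet> h N) \<longlonglongrightarrow> - (n \<bullet> p)"
    by simp
  have "(\<lambda>N. y - (2 * (y \<bullet> \<nu> N - \<nu> N \<bullet> h N)) *\<^sub>R \<nu> N)
    \<longlonglongrightarrow> y - (2 * (y \<bullet> - n - - (n \<bullet> p))) *\<^sub>R - n"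
    by (intro tendsto_intros \<nu> off)
  moreover have "y - (2 * (y \<bullet> - n - - (n \<bullet> p))) *\<^sub>R - n = reflection n p y"
    by (simp add: reflection_def inner_diff_left inner_commute algebra_simps)
  moreover have "y - (2 * (y \<bullet> \<nu> N - \<nu> N \<bullet> h N)) *\<^sub>R \<nu> N = reflection (\<nu> N) (h N) y" for N
    unfolding reflection_def inner_diff_left by (simp add: inner_commute)
  ultimately show ?thesis
    by (simp add: \<nu>_def h_def R_def)
qed

section \<open>The helix of basic points\<close>

abbreviation helix_angle :: real where
  "helix_angle \<equiv> arccos (- (2 / 3))"

lemma cos_helix_angle: "cos helix_angle = - (2/3)"
  by (rule cos_arccos) auto

lemma basic_point_shift:
  "basic_point (i + k) = screw (of_int k * helix_angle) (of_int k * (1 / sqrt 10)) (basic_point i)"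
  by (simp add: basic_point_def screw_def rotation_def coordinates_3 Let_def cos_add sin_add
      algebra_simps)

text \<open>The basic points continue the helix of tetrahedra: each new point is the mirror image of the point
  four places before. Coordinatewise the polynomial \<open>x\<^sup>4 - 2/3 (x\<^sup>3 + x\<^sup>2 + x) + 1\<close> is
  \<open>(x - 1)\<^sup>2 (x\<^sup>2 + 4/3 x + 1)\<close>. The double root 1 yields the heights, and the quadratic
  factor has the roots \<open>exp (\<plusminus>\<i>\<theta>)\<close>.\<close>
lemma basic_point_recurrence:
  "basic_point (i + 4) =
     (2/3) *\<^sub>R (basic_point (i + 1) + basic_point (i + 2) + basic_point (i + 3)) - basic_point i"
proof -
  have cos: "cos ((x + 2) * helix_angle) = - (4/3) * cos ((x + 1) * helix_angle) - cos (x * helix_angle)"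
    and sin: "sin ((x + 2) * helix_angle) = - (4/3) * sin ((x + 1) * helix_angle) - sin (x * helix_angle)" for x
  proof -
    have "cos ((x + 2) * helix_angle) = cos ((x + 1) * helix_angle + helix_angle)"
      and "cos (x * helix_angle) = cos ((x + 1) * helix_angle - helix_angle)"
      and "sin ((x + 2) * helix_angle) = sin ((x + 1) * helix_angle + helix_angle)"
      and "sin (x * helix_angle) = sin ((x + 1) * helix_angle - helix_angle)"
      by (simp_all add: algebra_simps)
    then show "cos ((x + 2) * helix_angle) = - (4/3) * cos ((x + 1) * helix_angle) - cos (x * helix_angle)"
      and "sin ((x + 2) * helix_angle) = - (4/3) * sin ((x + 1) * helix_angle) - sin (x * helix_angle)"
      unfolding cos_add cos_diff sin_add sin_diff cos_helix_angle by simp_all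
  qed
  have shift: "of_int i + 1 + (2::real) = of_int i + 3" "of_int i + 2 + (2::real) = of_int i + 4"
      "of_int i + 1 + (1::real) = of_int i + 2" "of_int i + 2 + (1::real) = of_int i + 3"
    by simp_all
  \<comment> \<open>The quadratic factor divides the quartic.\<close>
  have eliminate: "x4 = (2/3) * (x1 + x2 + x3) - x0"
    if "x2 = - (4/3) * x1 - x0" "x3 = - (4/3) * x2 - x1" "x4 = - (4/3) * x3 - x2" for x0 x1 x2 x3 x4 :: real
    using that by (simp add: field_simps)
  have "cos ((of_int i + 4) * helix_angle) = (2/3) * (cos ((of_int i + 1) * helix_angle)
      + cos ((of_int i + 2) * helix_angle) + cos ((of_int i + 3) * helix_angle)) - cos (of_int i * helix_angle)"
    using cos[of "of_int i"] cos[of "of_int i + 1"] cos[of "of_int i + 2"] unfolding shift by (rule eliminate)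
  moreover have "sin ((of_int i + 4) * helix_angle) = (2/3) * (sin ((of_int i + 1) * helix_angle)
      + sin ((of_int i + 2) * helix_angle) + sin ((of_int i + 3) * helix_angle)) - sin (of_int i * helix_angle)"
    using sin[of "of_int i"] sin[of "of_int i + 1"] sin[of "of_int i + 2"] unfolding shift by (rule eliminate)
  ultimately show ?thesis
    by (simp add: basic_point_def Let_def vec_eq_iff forall_3) (simp add: field_simps)
qed

lemma dist_vector_3:
  "(dist (vector [a, b, c] :: real ^ 3) (vector [a', b', c']))\<^sup>2 = (a - a')\<^sup>2 + (b - b')\<^sup>2 + (c - c')\<^sup>2"
  unfolding dist_norm power2_norm_eq_inner by (simp add: inner_vec_def sum_3 power2_eq_square)

lemma basic_point_dist:
  "(dist (basic_point i) (basic_point (i + k)))\<^sup>2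
     = 27/50 * (1 - cos (of_int k * helix_angle)) + (of_int k)\<^sup>2 / 10"
proof -
  let ?x = "of_int i * helix_angle" and ?y = "of_int (i + k) * helix_angle"
  define r h :: real where "r = 3 * sqrt 3 / 10" and "h = 1 / sqrt 10"
  have bp: "basic_point j = vector [r * cos (of_int j * helix_angle), r * sin (of_int j * helix_angle), of_int j * h]" for j
    by (simp add: basic_point_def r_def h_def Let_def)
  have "(dist (basic_point i) (basic_point (i + k)))\<^sup>2
      = r\<^sup>2 * ((cos ?x - cos ?y)\<^sup>2 + (sin ?x - sin ?y)\<^sup>2) + (of_int k)\<^sup>2 * h\<^sup>2"
    unfolding bp dist_vector_3 by (simp add: power2_eq_square algebra_simps del: sin_cos_squared_add3)
  also have "(cos ?x - cos ?y)\<^sup>2 + (sin ?x - sin ?y)\<^sup>2 = 2 * (1 - cos (?y - ?x))"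
  proof -
    have "sin ?x ^ 2 + cos ?x ^ 2 = 1" "sin ?y ^ 2 + cos ?y ^ 2 = 1" by simp_all
    then show ?thesis
      unfolding cos_diff by algebra
  qed
  also have "?y - ?x = of_int k * helix_angle"
    by (simp add: algebra_simps)
  also have "r\<^sup>2 = 27/100"
    by (simp add: r_def power_divide power_mult_distrib)
  also have "h\<^sup>2 = 1/10"
    by (simp add: h_def power_divide power_mult_distrib)
  finally show ?thesis by simp
qed

lemma basic_point_dist_eq_1:
  assumes "k \<in> {1, 2, 3}"
  shows "dist (basic_point i) (basic_point (i + k)) = 1"
proof -
  have "cos (2 * helix_angle) = - (1/9)"
    unfolding cos_double_cos cos_helix_angle by (simp add: power2_eq_square)
  moreover have "cos (3 * helix_angle) = 22/27"
    unfolding cos_treble_cos cos_helix_angle by (simp add: power3_eq_cube)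
  ultimately have "(dist (basic_point i) (basic_point (i + k)))\<^sup>2 = 1"
    using assms unfolding basic_point_dist by (auto simp: cos_helix_angle field_simps)
  then show ?thesis
    using zero_le_dist[of "basic_point i" "basic_point (i + k)"] by (auto simp: power2_eq_1_iff)
qed

lemma regular_base_tetrahedron: "regular base_tetrahedron"
proof -
  have *: "dist (basic_point i) (basic_point j) = 1" if "j - i \<in> {1, 2, 3}" for i j
    using basic_point_dist_eq_1[OF that, of i] by simp
  then show ?thesis
    unfolding regular_def labels_def base_tetrahedron_def
    by (auto simp: dist_commute * dest: sym)
qed

lemma flip_vertex_label:
  "flip_vertex 1 T = T(1 := (2/3) *\<^sub>R (T 2 + T 3 + T 4) - T 1)"
  "flip_vertex 2 T = T(2 := (2/3) *\<^sub>R (T 3 + T 4 + T 1) - T 2)"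
  "flip_vertex 3 T = T(3 := (2/3) *\<^sub>R (T 4 + T 1 + T 2) - T 3)"
  "flip_vertex 4 T = T(4 := (2/3) *\<^sub>R (T 1 + T 2 + T 3) - T 4)"
proof -
  have "labels - {1} = {2, 3, 4}" "labels - {2} = {3, 4, 1}" "labels - {3} = {4, 1, 2}" "labels - {4} = {1, 2, 3}"
    by (auto simp: labels_def)
  then show
    "flip_vertex 1 T = T(1 := (2/3) *\<^sub>R (T 2 + T 3 + T 4) - T 1)"
    "flip_vertex 2 T = T(2 := (2/3) *\<^sub>R (T 3 + T 4 + T 1) - T 2)"
    "flip_vertex 3 T = T(3 := (2/3) *\<^sub>R (T 4 + T 1 + T 2) - T 3)"
    "flip_vertex 4 T = T(4 := (2/3) *\<^sub>R (T 1 + T 2 + T 3) - T 4)"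
    by (simp_all add: flip_vertex_def add.assoc)
qed

text \<open>Four flips replace the vertices in order, each by the basic point four places further.\<close>
lemma represents_helix_period:
  "represents base_tetrahedron [1, 2, 3, 4] (screw (4 * helix_angle) (4 * (1 / sqrt 10)))"
proof -
  have V: "(2/3) *\<^sub>R (basic_point i + basic_point (i + 1) + basic_point (i + 2)) - basic_point (i - 1)
      = basic_point (i + 3)" for i
    using basic_point_recurrence[of "i - 1"] by (simp add: algebra_simps)
  have "act [1, 2, 3, 4] base_tetrahedron l = basic_point (int l - 2 + 4)" if "l \<in> labels" for l
    using that V[of 0] V[of 1] V[of 2] V[of 3]
    by (auto simp: labels_def flip_vertex_label flip_vertex_label(1)[unfolded One_nat_def]
        base_tetrahedron_def simp del: scaleR_add_right)
  then show ?thesis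
    unfolding represents_def basic_point_shift
    by (simp add: affine_map_screw labels_def base_tetrahedron_def)
qed

lemma represents_concat_replicate_screw:
  assumes "represents T w (screw \<phi> a)"
  shows "represents T (concat (replicate q w)) (screw (q * \<phi>) (q * a))"
proof (induction q)
  case 0
  have "screw 0 0 = (\<lambda>x. x)"
    by (simp add: fun_eq_iff screw_def rotation_def vec_eq_iff forall_3)
  then show ?case
    using affine_map_screw[of 0 0] by (simp add: represents_def)
next
  case (Suc q)
  have "screw \<phi> a \<circ> screw (q * \<phi>) (q * a) = screw (Suc q * \<phi>) (Suc q * a)"
    by (simp add: fun_eq_iff screw_screw algebra_simps)
  then show ?case
    using represents_append[OF assms Suc] by simp
qed

section \<open>The quadrahelix\<close>

lemma cyclic_string_eq: "cyclic_string m = map (\<lambda>k. k mod 4 + 1) [1..<m + 1]"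
proof -
  have "(THE l. l \<in> labels \<and> [l = k + 1] (mod 4)) = k mod 4 + 1" for k :: nat
    by (rule the_equality) (auto simp: labels_def cong_def; presburger)+
  then show ?thesis
    by (simp add: cyclic_string_def)
qed

lemma periodic_string:
  "map (\<lambda>k. k mod 4 + 1) [4 * b..<4 * (b + q)] = concat (replicate q [1, 2, 3, 4::nat])"
proof (induction q arbitrary: b)
  case (Suc q)
  have upt: "[4 * b..<4 * (b + Suc q)] = [4 * b, 4 * b + 1, 4 * b + 2, 4 * b + 3] @ [4 * (b + 1)..<4 * (b + 1 + q)]"
    by (simp add: upt_conv_Cons numeral_eq_Suc)
  have "(4 * b) mod 4 = 0" "(4 * b + 1) mod 4 = 1" "(4 * b + 2) mod 4 = 2" "(4 * b + 3) mod 4 = 3"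
    by presburger+
  then show ?case
    unfolding upt map_append Suc by simp
qed simp

lemma quadrahelix_eq:
  assumes "q > 0"
  defines "w \<equiv> concat (replicate q [1, 2, 3, 4])"
  shows "quadrahelix (4 * q - 1) = 1 # (tl w @ tl w) @ 1 # rev (tl w @ tl w)"
proof -
  let ?f = "\<lambda>k::nat. k mod 4 + 1"
  let ?L = "4 * q - 1"
  \<comment> \<open>The arms are the two periodic stretches on either side of the deleted position \<open>4q\<close>.\<close>
  have tl_w: "tl w = map ?f [4 * b + 1..<4 * (b + q)]" for b
    unfolding w_def periodic_string[of b, symmetric] map_tl[symmetric] tl_upt by simp
  have "2 * ?L + 1 + 1 = 4 * (q + q)"
    using assms(1) by simp
  then have cyclic: "cyclic_string (2 * ?L + 1) = map ?f [1..<4 * (q + q)]"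
    unfolding cyclic_string_eq by (simp only:)
  have "take ?L (cyclic_string (2 * ?L + 1)) = map ?f [1..<4 * q]"
    using assms(1) unfolding cyclic by (simp add: take_map del: upt_Suc)
  also have "\<dots> = tl w"
    using tl_w[of 0] by simp
  finally have 1: "take ?L (cyclic_string (2 * ?L + 1)) = tl w" .
  have "drop (?L + 1) (cyclic_string (2 * ?L + 1)) = map ?f [4 * q + 1..<4 * (q + q)]"
    using assms(1) unfolding cyclic by (simp add: drop_map del: upt_Suc)
  also have "\<dots> = tl w"
    using tl_w[of q] by simp
  finally have 2: "drop (?L + 1) (cyclic_string (2 * ?L + 1)) = tl w" .
  have "deleted_string (2 * ?L) = tl w @ tl w"
    unfolding deleted_string_def using 1 2 by simp
  moreover have "odd ?L"
    using assms(1) by simp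
  ultimately show ?thesis
    by (simp add: quadrahelix_def)
qed

text \<open>Dropping the first letter amounts to repeating it, since the repeated flip cancels.\<close>
lemma represents_tl:
  assumes "represents T (i # w) g" "represents T [i] f" "\<And>x. f (f x) = x"
  shows "represents T w (f \<circ> g)"
proof -
  have "represents T ([i] @ i # w) (f \<circ> g)"
    using assms(2,1) by (rule represents_append)
  then show ?thesis
    by (simp add: represents_def flip_vertex_flip_vertex)
qed

lemma represents_quadrahelix:
  assumes q: "q > 0" and n: "norm n = 1" and face: "represents base_tetrahedron [1] (reflection n p)"
  defines "R \<equiv> rotation (q * (4 * helix_angle))" and "s \<equiv> screw (q * (4 * helix_angle)) (q * (4 * (1 / sqrt 10)))"
  shows "represents base_tetrahedron (quadrahelix (4 * q - 1))
    (reflection (R (R n - (2 * (R n \<bullet> n)) *\<^sub>R n)) (s (reflection n p (s p))) \<circ> reflection n p)"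
proof -
  define w where "w = concat (replicate q [1::nat, 2, 3, 4])"
  have w: "w = 1 # tl w"
    using q by (cases q) (simp_all add: w_def)
  have s: "represents base_tetrahedron w s"
    unfolding w_def s_def by (intro represents_concat_replicate_screw represents_helix_period)
  moreover have "represents base_tetrahedron (tl w) (reflection n p \<circ> s)"
    using s w face by (intro represents_tl[where i = 1]) (simp_all add: reflection_reflection[OF n])
  ultimately have "represents base_tetrahedron (w @ tl w) (s \<circ> (reflection n p \<circ> s))"
    by (rule represents_append)
  then have h: "represents base_tetrahedron (1 # (tl w @ tl w)) (\<lambda>x. s (reflection n p (s x)))"
    using w by (simp add: comp_def) (metis append_Cons)
  define F where "F = (\<lambda>x. x - (2 * (x \<bullet> n)) *\<^sub>R n)"
  have F: "linear F"
    by (auto simp: F_def linear_iff algebra_simps)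
  have "F x \<bullet> F y = x \<bullet> y" for x y
    using n by (simp add: F_def norm_eq_1 inner_diff_left inner_diff_right inner_commute)
  then have inner: "R (F (R x)) \<bullet> R (F (R y)) = x \<bullet> y" for x y
    by (simp add: R_def rotation_inner)
  have R: "linear R"
    by (simp add: R_def linear_rotation)
  have lin: "linear (\<lambda>x. R (F (R x)))"
    using linear_compose[OF linear_compose[OF R F] R] by (simp add: comp_def)
  have "\<exists>t. \<forall>x. s (reflection n p (s x)) = R (F (R x)) + t"
  proof (intro exI allI)
    fix x
    have s_eq: "s y = R y + s 0" for y
      by (simp add: s_def R_def screw_def linear_0[OF linear_rotation])
    have "reflection n p y = F y + reflection n p 0" for y
      by (simp add: reflection_def F_def algebra_simps)
    then show "s (reflection n p (s x)) = R (F (R x)) + (R (F (s 0) + reflection n p 0) + s 0)"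
      by (metis (no_types, lifting) s_eq linear_add[OF R] linear_add[OF F] add.assoc)
  qed
  then obtain t where t: "\<And>x. s (reflection n p (s x)) = R (F (R x)) + t"
    by blast
  from represents_palindrome[OF h face lin inner t]
  show ?thesis
    unfolding quadrahelix_eq[OF q, folded w_def] by (simp add: F_def)
qed

section \<open>Small gaps\<close>

text \<open>The closed \<open>c\<close>-neighbourhood of a convex set is convex, so it suffices to look at the vertices.\<close>
lemma hausdorff_distance_solid_le:
  assumes "\<And>l. l \<in> labels \<Longrightarrow> dist (T l) (T' l) \<le> c"
  shows "hausdorff_distance (solid T) (solid T') \<le> c"
proof -
  have near: "\<exists>y\<in>solid Y. dist x y \<le> c"
    if XY: "\<And>l. l \<in> labels \<Longrightarrow> dist (X l) (Y l) \<le> c" and x: "x \<in> solid X" for X Y x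
  proof -
    let ?N = "\<Union>y\<in>solid Y. \<Union>z\<in>cball 0 c. {y + z}"
    have "X l \<in> ?N" if "l \<in> labels" for l
    proof -
      have "Y l \<in> solid Y"
        unfolding solid_def using that by (intro hull_inc) simp
      moreover have "X l - Y l \<in> cball 0 c"
        using XY[OF that] by (simp add: dist_norm norm_minus_commute)
      moreover have "X l = Y l + (X l - Y l)" by simp
      ultimately show ?thesis by blast
    qed
    then have "solid X \<subseteq> ?N"
      unfolding solid_def[of X]
      by (intro hull_minimal convex_sums) (auto simp: solid_def)
    with x obtain y z where "y \<in> solid Y" "norm z \<le> c" "x = y + z"
      by auto
    then show ?thesis
      by (intro bexI[of _ y]) (simp_all add: dist_norm)
  qed
  have "dist (T 1) (T' 1) \<le> c"
    using assms by (simp add: labels_def)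
  then have "0 \<le> c"
    using zero_le_dist order_trans by blast
  then show ?thesis
    unfolding hausdorff_distance_def
    using near[of T T'] near[of T' T] assms
    by (intro cInf_lower bdd_belowI[of _ 0]) (auto simp: dist_commute)
qed

text \<open>The gap is a minimum over the admissible initial letters, so the letter 1 gives an upper bound.\<close>
lemma gap_quadrahelix_le:
  assumes q: "q > 0"
    and c: "\<And>l. l \<in> labels \<Longrightarrow> dist (base_tetrahedron l) (act (quadrahelix (4 * q - 1)) base_tetrahedron l) \<le> c"
  shows "gap (reflection_sequence (quadrahelix (4 * q - 1))) \<le> c"
proof -
  let ?Q = "quadrahelix (4 * q - 1)"
  define w where "w = concat (replicate q [1::nat, 2, 3, 4])"
  have Q: "?Q = 1 # (tl w @ tl w) @ 1 # rev (tl w @ tl w)"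
    unfolding w_def by (rule quadrahelix_eq[OF q])
  have "set (tl w) \<subseteq> set w"
    by (cases w) auto
  also have "\<dots> \<subseteq> labels"
    by (auto simp: w_def labels_def)
  finally have labels: "set ?Q \<subseteq> labels"
    unfolding Q by (simp add: labels_def)
  have "tl w = 2 # tl (tl w)"
    using q by (cases q) (simp_all add: w_def)
  then obtain rs where rs: "?Q = 1 # 2 # rs"
    unfolding Q by (metis append_Cons)
  have "last (chain ?Q) = act ?Q base_tetrahedron"
    unfolding chain_def using labels
    by (intro last_chain_from regular_base_tetrahedron) (simp_all add: rs[unfolded One_nat_def])
  then have "hausdorff_distance (solid base_tetrahedron) (solid (last (chain ?Q))) \<le> c"
    using hausdorff_distance_solid_le[OF c] by simp
  then show ?thesis
    unfolding gap_def reflection_sequence_def rs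
    by (intro Min_le[THEN order_trans]) (auto simp: labels_def)
qed

text \<open>Dirichlet's theorem for \<open>\<psi>/2\<pi>\<close> gives \<open>q \<le> N + 1\<close> with \<open>q\<psi>\<close> within \<open>2\<pi>/(N + 1)\<close> of a multiple of
  \<open>2\<pi>\<close>. The bound on \<open>1 - cos\<close> is quadratic in this distance and outweighs the factor \<open>q\<close>.\<close>
lemma exists_multiples_cos_close:
  fixes \<psi> :: real
  shows "\<exists>q::nat \<Rightarrow> nat. (\<forall>N. (0::nat) < q N) \<and> (\<lambda>N. q N * (1 - cos (q N * \<psi>))) \<longlonglongrightarrow> 0"
proof -
  have "\<exists>k. (0::nat) < k \<and> k * (1 - cos (k * \<psi>)) \<le> 2 * pi\<^sup>2 / Suc N" for N
  proof -
    obtain k m where k: "0 < k" "k \<le> int (Suc N)"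
      and km: "\<bar>of_int k * (\<psi> / (2 * pi)) - of_int m\<bar> < 1 / real (Suc N)"
      using Dirichlet_approx[of "Suc N" "\<psi> / (2 * pi)", OF zero_less_Suc] by blast
    define y where "y = pi * (of_int k * (\<psi> / (2 * pi)) - of_int m)"
    have "2 * y = of_int k * \<psi> - 2 * pi * of_int m"
      by (simp add: y_def field_simps)
    then have "cos (of_int k * \<psi>) = cos (2 * y)"
      by (simp add: cos_diff)
    then have "1 - cos (of_int k * \<psi>) = 2 * (sin y)\<^sup>2"
      by (simp add: cos_double_sin)
    also have "\<dots> \<le> 2 * y\<^sup>2"
      using abs_sin_x_le_abs_x[of y] by (simp add: abs_le_square_iff)
    also have "y\<^sup>2 \<le> (pi / Suc N)\<^sup>2"
    proof -
      have "\<bar>y\<bar> \<le> pi / Suc N"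
        using km mult_left_mono[OF less_imp_le[OF km], of pi] by (simp add: y_def abs_mult)
      then show ?thesis
        by (metis abs_ge_zero power2_abs power_mono)
    qed
    finally have "of_int k * (1 - cos (of_int k * \<psi>)) \<le> Suc N * (2 * (pi / Suc N)\<^sup>2)"
      using k by (intro mult_mono) auto
    also have "\<dots> = 2 * pi\<^sup>2 / Suc N"
      by (simp add: power2_eq_square divide_simps del: of_nat_Suc)
    finally show ?thesis
      using k by (intro exI[of _ "nat k"]) simp
  qed
  then have "\<exists>q. \<forall>N. (0::nat) < q N \<and> q N * (1 - cos (q N * \<psi>)) \<le> 2 * pi\<^sup>2 / Suc N"
    by (intro choice allI)
  then obtain q :: "nat \<Rightarrow> nat" where q: "\<And>N. q N > 0" "\<And>N. q N * (1 - cos (q N * \<psi>)) \<le> 2 * pi\<^sup>2 / Suc N"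
    by blast
  have "(\<lambda>N. 2 * pi\<^sup>2 / Suc N) \<longlonglongrightarrow> 0"
    using tendsto_mult_right_zero[OF LIMSEQ_inverse_real_of_nat, of "2 * pi\<^sup>2"] by (simp add: divide_inverse)
  then have "(\<lambda>N. q N * (1 - cos (q N * \<psi>))) \<longlonglongrightarrow> 0"
    by (rule tendsto_sandwich[rotated 3]) (auto simp: q simp del: of_nat_Suc)
  then show ?thesis
    using q(1) by blast
qed

theorem theorem5:
  shows "\<forall>\<epsilon>::real. \<epsilon> > 0 \<longrightarrow>
    (\<exists>L::nat. L > 0 \<and> gap (reflection_sequence (quadrahelix L)) < \<epsilon>)"
proof (intro allI impI)
  fix \<epsilon> :: real
  assume "\<epsilon> > 0"
  obtain q :: "nat \<Rightarrow> nat" where q: "\<And>N. q N > 0"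
    and lim: "(\<lambda>N. q N * (1 - cos (q N * (4 * helix_angle)))) \<longlonglongrightarrow> 0"
    using exists_multiples_cos_close[of "4 * helix_angle"] by auto
  define \<phi> a where "\<phi> = (\<lambda>N. q N * (4 * helix_angle))" and "a = (\<lambda>N. q N * (4 * (1 / sqrt 10)))"
  \<comment> \<open>As \<open>q \<ge> 1\<close>, the stronger limit already forces the angles to converge modulo full turns.\<close>
  have "(\<lambda>N. 1 - cos (\<phi> N)) \<longlonglongrightarrow> 0"
  proof (rule tendsto_sandwich[OF _ _ tendsto_const lim])
    have "1 * (1 - cos (\<phi> N)) \<le> q N * (1 - cos (\<phi> N))" for N
      using q[of N] by (intro mult_right_mono) auto
    then show "\<forall>\<^sub>F N in sequentially. 1 - cos (\<phi> N) \<le> q N * (1 - cos (q N * (4 * helix_angle)))"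
      by (simp add: \<phi>_def)
  qed simp
  from tendsto_diff[OF tendsto_const[of 1] this] have cos: "(\<lambda>N. cos (\<phi> N)) \<longlonglongrightarrow> 1"
    by simp
  have a: "(\<lambda>N. a N * (1 - cos (\<phi> N))) \<longlonglongrightarrow> 0"
    using tendsto_mult_right_zero[OF lim, of "4 * (1 / sqrt 10)"] by (simp add: a_def \<phi>_def mult_ac)
  obtain n p where n: "norm n = 1"
    and "\<forall>l\<in>labels. flip_vertex 1 base_tetrahedron l = reflection n p (base_tetrahedron l)"
    using flip_vertex_regular(2)[OF regular_base_tetrahedron, of 1] by (auto simp: labels_def)
  then have face: "represents base_tetrahedron [1] (reflection n p)"
    by (simp add: represents_def affine_map_reflection labels_def)
  have "(\<lambda>N. act (quadrahelix (4 * q N - 1)) base_tetrahedron l) \<longlonglongrightarrow> base_tetrahedron l"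
    if "l \<in> labels" for l
    using bent_screw_plane_tendsto[OF n cos a, of p "reflection n p (base_tetrahedron l)"]
      represents_quadrahelix[OF q n face] that
    by (simp add: represents_def \<phi>_def a_def reflection_reflection[OF n])
  then have "\<forall>l\<in>labels. \<forall>\<^sub>F N in sequentially.
      dist (act (quadrahelix (4 * q N - 1)) base_tetrahedron l) (base_tetrahedron l) < \<epsilon> / 2"
    using \<open>\<epsilon> > 0\<close> by (intro ballI tendstoD) auto
  then have "\<forall>\<^sub>F N in sequentially. \<forall>l\<in>labels.
      dist (act (quadrahelix (4 * q N - 1)) base_tetrahedron l) (base_tetrahedron l) < \<epsilon> / 2"
    by (rule eventually_ball_finite[rotated]) (simp add: labels_def)
  then obtain N where N: "\<And>l. l \<in> labels \<Longrightarrow>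
      dist (base_tetrahedron l) (act (quadrahelix (4 * q N - 1)) base_tetrahedron l) < \<epsilon> / 2"
    by (auto simp: eventually_sequentially dist_commute)
  have "gap (reflection_sequence (quadrahelix (4 * q N - 1))) \<le> \<epsilon> / 2"
    using N by (intro gap_quadrahelix_le q less_imp_le)
  then show "\<exists>L. L > 0 \<and> gap (reflection_sequence (quadrahelix L)) < \<epsilon>"
    using q[of N] \<open>\<epsilon> > 0\<close> by (intro exI[of _ "4 * q N - 1"]) auto
qed

end
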